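(* Let $F$ be a Boolean CNF formula on $n$ variables, let $\sqrt2-1\le\varepsilon<1$, and suppose $|\mathsf{sol}(F)|\ge\mathsf{thresh}$. For odd $t\ge1$, let $\mathsf{Error}_t$ be the event that the median of the values returned by $t$ independent invocations of the core procedure on $F$ with tolerance $\varepsilon$ lies outside $\left[\frac{|\mathsf{sol}(F)|}{1+\varepsilon},(1+\varepsilon)|\mathsf{sol}(F)|\right]$. Then, as $t\to\infty$ (over odd $t$): (i) if the core procedure is RoundMCCore, $\Pr[\mathsf{Error}_t]\in O\!\left(t^{-1/2}\,0.75^t\right)$; (ii) if the core procedure is ApproxMCCore, $\Pr[\mathsf{Error}_t]\in O\!\left(t^{-1/2}\,0.96^t\right)$.
   Context: $\mathsf{sol}(F)\subseteq\{0,1\}^n$ is the set of satisfying assignments of $F$. $\mathsf{pivot}=9.84\left(1+\frac1\varepsilon\right)^2$ and $\mathsf{thresh}=9.84\left(1+\frac{\varepsilon}{1+\varepsilon}\right)\left(1+\frac1\varepsilon\right)^2$. $\mathcal H(n,n)$ is a strongly 2-universal family of functions $h:\{0,1\}^n\to\{0,1\}^n$: for $h$ uniform in $\mathcal H(n,n)$, all distinct $x,y\in\{0,1\}^n$ and all $\alpha,\beta\in\{0,1\}^n$, $\Pr[h(x)=\alpha]=2^{-n}$ and $\Pr[h(x)=\alpha\wedge h(y)=\beta]=2^{-2n}$. For $1\le m\le n$, $h^{(m)}(y)$ and $\alpha^{(m)}$ denote the first $m$ coordinates of $h(y)$ and of $\alpha\in\{0,1\}^n$. Set $\mathsf{Cnt}_m=|\{y\in\mathsf{sol}(F):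 h^{(m)}(y)=\alpha^{(m)}\}|$ for $1\le m\le n$ and $\mathsf{Cnt}_0=|\mathsf{sol}(F)|$. Both core procedures start as follows: choose $h$ uniformly from $\mathcal H(n,n)$ and, independently, $\alpha$ uniformly from $\{0,1\}^n$. Let $m$ be the unique index in $\{1,\dots,n\}$ with $\mathsf{Cnt}_{m-1}\ge\mathsf{thresh}$ and $\mathsf{Cnt}_m<\mathsf{thresh}$ (if there is none, i.e. $\mathsf{Cnt}_n\ge \mathsf{thresh}$, put $m=n$). Let $c$ be the number of elements of the cell $\{y\in\mathsf{sol}(F):h^{(m)}(y)=\alpha^{(m)}\}$ enumerated, stopping after $\lceil\mathsf{thresh}\rceil$ elements; so $c=\mathsf{Cnt}_m$ whenever $\mathsf{Cnt}_m<\mathsf{thresh}$. ApproxMCCore returns $2^m\cdot c$. RoundMCCore, in the range $\sqrt2-1\le\varepsilon<1$, returns $2^m\cdot\max\left\{c,\frac{\mathsf{pivot}}{\sqrt2}\right\}$. *)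

theory Defs
  imports
    "HOL-Probability.Probability"
    "HOL-Library.FuncSet"
    "HOL-Library.Landau_Symbols"
begin

section \<open>Boolean CNF formulas\<close>

text \<open>A truth assignment to the variables $0, \dots, n-1$ is a bit string of length $n$,
  represented as a \<^typ>\<open>bool list\<close>.\<close>

definition cube :: "nat \<Rightarrow> bool list set" where
  "cube n = {xs. length xs = n}"

datatype literal = Pos nat | Neg nat

fun var :: "literal \<Rightarrow> nat" where
  "var (Pos i) = i"
| "var (Neg i) = i"

fun lit_holds :: "bool list \<Rightarrow> literal \<Rightarrow> bool" where
  "lit_holds \<sigma> (Pos i) \<longleftrightarrow> \<sigma> ! i"
| "lit_holds \<sigma> (Neg i) \<longleftrightarrow> \<not> \<sigma> ! i"

type_synonym clause = "literal list"
type_synonym cnf = "clause list"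

definition cnf_over :: "nat \<Rightarrow> cnf \<Rightarrow> bool" where
  "cnf_over n F \<longleftrightarrow> (\<forall>C\<in>set F. \<forall>l\<in>set C. var l < n)"

definition satisfies :: "bool list \<Rightarrow> cnf \<Rightarrow> bool" where
  "satisfies \<sigma> F \<longleftrightarrow> (\<forall>C\<in>set F. \<exists>l\<in>set C. lit_holds \<sigma> l)"

definition sol :: "nat \<Rightarrow> cnf \<Rightarrow> bool list set" where
  "sol n F = {\<sigma> \<in> cube n. satisfies \<sigma> F}"

section \<open>Strongly 2-universal hashing\<close>

type_synonym hash = "bool list \<Rightarrow> bool list"

text \<open>The extensional function space makes \<^term>\<open>H\<close> a genuine set of maps
  $\{0,1\}^n \to \{0,1\}^n$: two members that agree on \<^term>\<open>cube n\<close> are equal. In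
  particular \<^term>\<open>H\<close> is finite, so \<^term>\<open>pmf_of_set H\<close> is the uniform distribution.\<close>

definition strongly_2_universal :: "nat \<Rightarrow> hash set \<Rightarrow> bool" where
  "strongly_2_universal n H \<longleftrightarrow>
     H \<noteq> {} \<and> H \<subseteq> cube n \<rightarrow>\<^sub>E cube n \<and>
     (\<forall>x\<in>cube n. \<forall>y\<in>cube n. x \<noteq> y \<longrightarrow>
       (\<forall>\<alpha>\<in>cube n. \<forall>\<beta>\<in>cube n.
          measure_pmf.prob (pmf_of_set H) {h. h x = \<alpha>} = 1 / 2 ^ n \<and>
          measure_pmf.prob (pmf_of_set H) {h. h x = \<alpha> \<and> h y = \<beta>} = 1 / 2 ^ (2 * n)))"

lemma finite_cube [simp]: "finite (cube n)"
  using finite_lists_length_eq[of "UNIV :: bool set" n] by (simp add: cube_def)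

lemma cube_nonempty [simp]: "cube n \<noteq> {}"
  unfolding cube_def using length_replicate[of n True] by blast

lemma finite_sol [simp]: "finite (sol n F)"
  by (simp add: sol_def)

lemma strongly_2_universal_finite:
  assumes "strongly_2_universal n H"
  shows "finite H"
proof -
  have "finite (cube n \<rightarrow>\<^sub>E cube n)"
    by (intro finite_PiE) auto
  thus ?thesis
    using assms unfolding strongly_2_universal_def by (auto intro: finite_subset)
qed

section \<open>The core counting procedures\<close>

definition pivot :: "real \<Rightarrow> real" where
  "pivot \<epsilon> = 9.84 * (1 + 1 / \<epsilon>) ^ 2"

definition thresh :: "real \<Rightarrow> real" where
  "thresh \<epsilon> = 9.84 * (1 + \<epsilon> / (1 + \<epsilon>)) * (1 + 1 / \<epsilon>) ^ 2"

definition cell :: "nat \<Rightarrow> cnf \<Rightarrow> hash \<Rightarrow> bool list \<Rightarrow> nat \<Rightarrow> bool list set" where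
  "cell n F h \<alpha> m = {y \<in> sol n F. take m (h y) = take m \<alpha>}"

definition cnt :: "nat \<Rightarrow> cnf \<Rightarrow> hash \<Rightarrow> bool list \<Rightarrow> nat \<Rightarrow> nat" where
  "cnt n F h \<alpha> m = card (cell n F h \<alpha> m)"

lemma cnt_0: "cnt n F h \<alpha> 0 = card (sol n F)"
  by (simp add: cnt_def cell_def)

lemma cnt_antimono:
  assumes "m \<le> m'"
  shows "cnt n F h \<alpha> m' \<le> cnt n F h \<alpha> m"
proof -
  have "take m (h y) = take m \<alpha>" if "take m' (h y) = take m' \<alpha>" for y
    using that assms by (metis min.absorb1 take_take)
  hence "cell n F h \<alpha> m' \<subseteq> cell n F h \<alpha> m"
    by (auto simp: cell_def)
  thus ?thesis
    unfolding cnt_def by (intro card_mono) (auto simp: cell_def)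
qed

definition is_crossing :: "nat \<Rightarrow> cnf \<Rightarrow> real \<Rightarrow> hash \<Rightarrow> bool list \<Rightarrow> nat \<Rightarrow> bool" where
  "is_crossing n F \<epsilon> h \<alpha> m \<longleftrightarrow> m \<in> {1..n} \<and>
     real (cnt n F h \<alpha> (m - 1)) \<ge> thresh \<epsilon> \<and> real (cnt n F h \<alpha> m) < thresh \<epsilon>"

lemma is_crossing_unique:
  assumes "is_crossing n F \<epsilon> h \<alpha> m" "is_crossing n F \<epsilon> h \<alpha> m'"
  shows "m = m'"
proof -
  have "\<not> m1 < m2" if "is_crossing n F \<epsilon> h \<alpha> m1" "is_crossing n F \<epsilon> h \<alpha> m2" for m1 m2
  proof
    assume "m1 < m2"
    hence "cnt n F h \<alpha> (m2 - 1) \<le> cnt n F h \<alpha> m1"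
      by (intro cnt_antimono) auto
    thus False
      using that unfolding is_crossing_def by linarith
  qed
  thus ?thesis
    using assms by (meson linorder_neqE_nat)
qed

definition chosen_index :: "nat \<Rightarrow> cnf \<Rightarrow> real \<Rightarrow> hash \<Rightarrow> bool list \<Rightarrow> nat" where
  "chosen_index n F \<epsilon> h \<alpha> =
     (if \<exists>m. is_crossing n F \<epsilon> h \<alpha> m then THE m. is_crossing n F \<epsilon> h \<alpha> m else n)"

text \<open>The size of the chosen cell as seen by an enumeration that stops after
  $\lceil\mathsf{thresh}\rceil$ elements.\<close>

definition enumerated :: "nat \<Rightarrow> cnf \<Rightarrow> real \<Rightarrow> hash \<Rightarrow> bool list \<Rightarrow> nat" where
  "enumerated n F \<epsilon> h \<alpha> =
     min (cnt n F h \<alpha> (chosen_index n F \<epsilon> h \<alpha>)) (nat \<lceil>thresh \<epsilon>\<rceil>)"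

text \<open>The joint distribution of the pair $(m, c)$.\<close>

definition core_sample :: "nat \<Rightarrow> cnf \<Rightarrow> hash set \<Rightarrow> real \<Rightarrow> (nat \<times> nat) pmf" where
  "core_sample n F H \<epsilon> = do {
     h \<leftarrow> pmf_of_set H;
     \<alpha> \<leftarrow> pmf_of_set (cube n);
     return_pmf (chosen_index n F \<epsilon> h \<alpha>, enumerated n F \<epsilon> h \<alpha>)
   }"

definition ApproxMCCore :: "nat \<Rightarrow> cnf \<Rightarrow> hash set \<Rightarrow> real \<Rightarrow> real pmf" where
  "ApproxMCCore n F H \<epsilon> = map_pmf (\<lambda>(m, c). 2 ^ m * real c) (core_sample n F H \<epsilon>)"

text \<open>The rounding value \<^term>\<open>pivot \<epsilon> / sqrt 2\<close> is the one used for tolerances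
  $\sqrt 2 - 1 \le \varepsilon < 1$; the definition is meant for this range only.\<close>

definition RoundMCCore :: "nat \<Rightarrow> cnf \<Rightarrow> hash set \<Rightarrow> real \<Rightarrow> real pmf" where
  "RoundMCCore n F H \<epsilon> =
     map_pmf (\<lambda>(m, c). 2 ^ m * max (real c) (pivot \<epsilon> / sqrt 2)) (core_sample n F H \<epsilon>)"

section \<open>The median of independent invocations\<close>

text \<open>The middle element of the sorted list; used for lists of odd length only.\<close>

definition median :: "real list \<Rightarrow> real" where
  "median xs = sort xs ! (length xs div 2)"

definition Error :: "nat \<Rightarrow> cnf \<Rightarrow> real \<Rightarrow> real list set" where
  "Error n F \<epsilon> =
     {xs. median xs \<notin> {real (card (sol n F)) / (1 + \<epsilon>) .. (1 + \<epsilon>) * real (card (sol n F))}}"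

definition error_prob :: "nat \<Rightarrow> cnf \<Rightarrow> real \<Rightarrow> real pmf \<Rightarrow> nat \<Rightarrow> real" where
  "error_prob n F \<epsilon> core t = measure_pmf.prob (replicate_pmf t core) (Error n F \<epsilon>)"

definition odd_at_top :: "nat filter" where
  "odd_at_top = inf at_top (principal {t. odd t})"

end

theory Submission
  imports Defs "HOL-Real_Asymp.Real_Asymp"
begin

text \<open>For every fixed \<open>\<alpha>\<close> and \<open>i \<le> n\<close>, pairwise independence of the hash gives the cell size \<open>Cnt\<^sub>i\<close>
  mean \<open>\<mu>\<^sub>i = |sol(F)| / 2\<^sup>i\<close> and variance at most \<open>\<mu>\<^sub>i\<close>. Let \<open>m\<^sup>*\<close> (\<open>level\<close> below) be the least \<open>i\<close> with
  \<open>\<mu>\<^sub>i \<le> pivot\<close>, so \<open>\<mu>\<close> exceeds \<open>pivot/2\<close> at \<open>m\<^sup>*\<close> and doubles with every step below it. An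
  overestimate forces \<open>Cnt\<close> at \<open>m\<^sup>*\<close> to exceed its mean by a factor \<open>1 + \<epsilon>/(1+\<epsilon>)\<close>, which by
  Cantelli's inequality has probability at most \<open>1/5.92\<close>. Rounding up to \<open>pivot / sqrt 2\<close> rules out
  underestimates at \<open>m\<^sup>*\<close> and beyond, so that an underestimate comes from a small cell at \<open>m\<^sup>* - 1\<close>,
  \<open>m\<^sup>* - 2\<close> or \<open>m\<^sup>* - 3\<close>, with probability at most \<open>1/10.84 + 1/20.68 + 1/62.5\<close>. Without rounding the
  two-sided deviation at \<open>m\<^sup>*\<close>, of probability at most \<open>1/4.92\<close> by Chebyshev, has to be added.

  The median errs on one side only if half of the samples do. By Chernoff's argument this has
  probability at most \<open>(2 sqrt (q (1 - q)))\<^sup>t\<close> if a single sample errs with probability at most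
  \<open>q \<le> 1/2\<close>. For \<open>q = 0.169\<close> and \<open>q = 0.3599\<close> the base is strictly below 0.75 and 0.96, which
  leaves room for the factor \<open>t powr (-1/2)\<close>.\<close>

section \<open>One-sided tail bounds\<close>

text \<open>Markov's inequality for the square of the deviation shifted by \<open>u\<close>. For one
  tail this improves Chebyshev's \<open>v / a\<^sup>2\<close>.\<close>

lemma (in prob_space) Cantelli_inequality:
  fixes f :: "'a \<Rightarrow> real"
  assumes [measurable]: "random_variable borel f"
    and sq: "integrable M (\<lambda>x. f x ^ 2)"
    and var: "variance f \<le> v" and "v > 0" and "a > 0"
  shows "prob {x \<in> space M. f x \<ge> expectation f + a} \<le> v / (v + a\<^sup>2)"
proof -
  define \<mu> where "\<mu> = expectation f"
  \<comment> \<open>This shift minimises \<open>(v + u\<^sup>2) / (a + u)\<^sup>2\<close>.\<close>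
  define u where "u = v / a"
  have "u > 0"
    using assms by (simp add: u_def)
  have int: "integrable M f"
    using square_integrable_imp_integrable[OF _ sq] by simp
  have int_dev: "integrable M (\<lambda>x. (f x - \<mu>)\<^sup>2)"
    using int sq unfolding power2_diff by (intro Bochner_Integration.integrable_add
      Bochner_Integration.integrable_diff integrable_const) (auto intro: integrable_mult_left)
  have shift: "(f x - \<mu> + u)\<^sup>2 = (f x - \<mu>)\<^sup>2 + 2 * u * (f x - \<mu>) + u\<^sup>2" for x
    by (simp add: power2_eq_square algebra_simps)
  have int_shift: "integrable M (\<lambda>x. (f x - \<mu> + u)\<^sup>2)"
    unfolding shift using int int_dev by auto
  have "expectation (\<lambda>x. (f x - \<mu> + u)\<^sup>2) = variance f + u\<^sup>2"
    unfolding shift using int int_dev by (simp add: \<mu>_def prob_space)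
  moreover have "prob {x \<in> space M. f x \<ge> \<mu> + a} \<le> prob {x \<in> space M. (f x - \<mu> + u)\<^sup>2 \<ge> (a + u)\<^sup>2}"
    using \<open>a > 0\<close> \<open>u > 0\<close> by (intro finite_measure_mono) (auto intro!: power_mono)
  moreover have "\<dots> \<le> expectation (\<lambda>x. (f x - \<mu> + u)\<^sup>2) / (a + u)\<^sup>2"
    using \<open>a > 0\<close> \<open>u > 0\<close> int_shift by (intro integral_Markov_inequality_measure[where A = "{}"]) auto
  ultimately have "prob {x \<in> space M. f x \<ge> \<mu> + a} \<le> (variance f + u\<^sup>2) / (a + u)\<^sup>2"
    by simp
  also have "\<dots> \<le> (v + u\<^sup>2) / (a + u)\<^sup>2"
    using var by (intro divide_right_mono) auto
  also have "v + u\<^sup>2 = v * (v + a\<^sup>2) / a\<^sup>2"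
    using \<open>a > 0\<close> by (simp add: u_def field_simps power2_eq_square)
  also have "a + u = (v + a\<^sup>2) / a"
    using \<open>a > 0\<close> by (simp add: u_def field_simps power2_eq_square)
  also have "v * (v + a\<^sup>2) / a\<^sup>2 / ((v + a\<^sup>2) / a)\<^sup>2 = v / (v + a\<^sup>2)"
    using \<open>a > 0\<close> by (simp add: power_divide) (simp add: power2_eq_square)
  finally show ?thesis
    by (simp add: \<mu>_def)
qed

section \<open>The median of independent samples\<close>

lemma length_filter_sort: "length (filter P (sort xs)) = length (filter P xs)"
  by (metis mset_filter mset_sort size_mset)

text \<open>The sorted entries \<open>0..k\<close> with \<open>k = length xs div 2\<close> are at
  most the median, and \<open>2 * (k + 1)\<close> exceeds the length. The empty list has no middle
  entry and is treated apart.\<close>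

lemma median_less_imp_half:
  assumes "median xs < a"
  shows "length xs \<le> 2 * length (filter (\<lambda>x. x < a) xs)"
proof (cases "xs = []")
  case False
  let ?ys = "sort xs" and ?k = "length xs div 2"
  have k: "?k < length ?ys"
    using False by simp
  have "?ys ! i < a" if "i \<le> ?k" for i
    using sorted_nth_mono[OF sorted_sort that k] assms by (simp add: median_def)
  hence "{..?k} \<subseteq> {i. i < length ?ys \<and> ?ys ! i < a}"
    using k by auto
  hence "card {..?k} \<le> length (filter (\<lambda>x. x < a) ?ys)"
    unfolding length_filter_conv_card by (intro card_mono) auto
  thus ?thesis
    unfolding length_filter_sort by simp
qed simp

text \<open>The sorted entries from the middle on are at least the median; they are at least half of
  the list because \<open>div\<close> rounds down.\<close>

lemma median_greater_imp_half:
  assumes "median xs > b"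
  shows "length xs \<le> 2 * length (filter (\<lambda>x. x > b) xs)"
proof -
  let ?ys = "sort xs" and ?k = "length xs div 2"
  have "?ys ! i > b" if "?k \<le> i" "i < length ?ys" for i
    using sorted_nth_mono[OF sorted_sort that] assms by (simp add: median_def)
  hence "{?k..<length ?ys} \<subseteq> {i. i < length ?ys \<and> ?ys ! i > b}"
    by auto
  hence "card {?k..<length ?ys} \<le> length (filter (\<lambda>x. x > b) ?ys)"
    unfolding length_filter_conv_card by (intro card_mono) auto
  thus ?thesis
    unfolding length_filter_sort by simp
qed

lemma nn_integral_replicate_pmf_prod_list:
  "(\<integral>\<^sup>+xs. prod_list (map f xs) \<partial>replicate_pmf t p) = (\<integral>\<^sup>+x. f x \<partial>p) ^ t"
  by (induction t) (simp_all add: nn_integral_cmult nn_integral_multc mult.commute)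

text \<open>Chernoff's argument: the weight \<open>r\<close> for a hit and \<open>1 / r\<close> for a miss makes the product of
  the weights at least 1 as soon as half of the samples are hits.\<close>

lemma prob_half_hits_le:
  fixes p :: "'a pmf"
  assumes prob: "measure_pmf.prob p {x. P x} \<le> q" and "r \<ge> 1"
  shows "measure_pmf.prob (replicate_pmf t p) {xs. length xs \<le> 2 * length (filter P xs)}
    \<le> (q * r + (1 - q) / r) ^ t"
proof -
  define f where "f x = (if P x then r else 1 / r)" for x
  have "r > 0" using \<open>r \<ge> 1\<close> by simp
  have f_pos: "f x > 0" for x
    using \<open>r > 0\<close> by (simp add: f_def)
  \<comment> \<open>Scaling each weight by \<open>r\<close> turns it into \<open>r\<^sup>2\<close>
    or 1, so that only the number of hits counts.\<close>
  have prod_eq: "prod_list (map f xs) * r ^ length xs = r ^ (2 * length (filter P xs))" for xs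
  proof (induction xs)
    case (Cons x xs)
    have "prod_list (map f (x # xs)) * r ^ length (x # xs)
        = (f x * r) * (prod_list (map f xs) * r ^ length xs)"
      by simp
    also have "\<dots> = (f x * r) * r ^ (2 * length (filter P xs))"
      unfolding Cons.IH ..
    also have "f x * r = (if P x then r\<^sup>2 else 1)"
      using \<open>r > 0\<close> by (simp add: f_def power2_eq_square)
    finally show ?case
      by (simp add: power2_eq_square)
  qed simp
  have prod_ge: "prod_list (map f xs) \<ge> 1" if "length xs \<le> 2 * length (filter P xs)" for xs
  proof -
    have "1 * r ^ length xs \<le> prod_list (map f xs) * r ^ length xs"
      unfolding prod_eq using power_increasing[OF that \<open>r \<ge> 1\<close>] by simp
    thus ?thesis
      using \<open>r > 0\<close> by (simp only: mult_le_cancel_right) auto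
  qed
  have prod_nonneg: "0 \<le> prod_list (map f xs)" for xs
    using f_pos by (induction xs) (simp_all add: less_imp_le)
  have prod_ennreal: "ennreal (prod_list (map f xs)) = prod_list (map (\<lambda>x. ennreal (f x)) xs)" for xs
    by (induction xs) (use f_pos prod_nonneg in \<open>simp_all add: ennreal_mult less_imp_le\<close>)
  define s where "s = measure_pmf.prob p {x. P x}"
  have compl: "measure_pmf.prob p {x. \<not> P x} = 1 - s"
    using measure_pmf.prob_compl[of "{x. P x}" p] by (simp add: s_def Compl_eq[symmetric] Collect_neg_eq Compl_eq_Diff_UNIV)
  have s: "0 \<le> s" "s \<le> 1" "s \<le> q"
    using prob by (simp_all add: s_def)
  have "(\<integral>\<^sup>+x. ennreal (f x) \<partial>p)
      = (\<integral>\<^sup>+x. ennreal r * indicator {x. P x} x + ennreal (1 / r) * indicator {x. \<not> P x} x \<partial>p)"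
    by (intro nn_integral_cong) (auto simp: f_def)
  also have "\<dots> = ennreal r * s + ennreal (1 / r) * (1 - s)"
    by (simp add: nn_integral_add nn_integral_cmult measure_pmf.emeasure_eq_measure compl s_def)
  also have "\<dots> = ennreal (r * s + (1 / r) * (1 - s))"
    using s \<open>r > 0\<close> by (subst ennreal_plus) (simp_all add: ennreal_mult'[symmetric])
  finally have int_f: "(\<integral>\<^sup>+x. ennreal (f x) \<partial>p) = ennreal (r * s + (1 / r) * (1 - s))" .
  have "emeasure (replicate_pmf t p) {xs. length xs \<le> 2 * length (filter P xs)}
      = (\<integral>\<^sup>+xs. indicator {xs. length xs \<le> 2 * length (filter P xs)} xs \<partial>replicate_pmf t p)"
    by simp
  also have "\<dots> \<le> (\<integral>\<^sup>+xs. prod_list (map (\<lambda>x. ennreal (f x)) xs) \<partial>replicate_pmf t p)"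
    using prod_ge by (intro nn_integral_mono) (auto simp: prod_ennreal[symmetric] indicator_def)
  also have "\<dots> = ennreal ((r * s + (1 / r) * (1 - s)) ^ t)"
    using s \<open>r > 0\<close> by (simp add: nn_integral_replicate_pmf_prod_list int_f ennreal_power del: ennreal_plus)
  finally have "measure_pmf.prob (replicate_pmf t p) {xs. length xs \<le> 2 * length (filter P xs)}
      \<le> (r * s + (1 / r) * (1 - s)) ^ t"
    using s \<open>r > 0\<close> by (simp add: measure_pmf.emeasure_eq_measure)
  \<comment> \<open>The base is affine in the hit probability with slope \<open>r - 1 / r\<close>,
    nonnegative for \<open>r \<ge> 1\<close>, so \<open>s\<close> may be raised to
    \<open>q\<close>.\<close>
  also have "\<dots> \<le> (q * r + (1 - q) / r) ^ t"
  proof (intro power_mono)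
    have "1 / r \<le> r"
      using \<open>r \<ge> 1\<close> by (smt (verit) divide_le_eq_1)
    hence "s * (r - 1 / r) \<le> q * (r - 1 / r)"
      using s by (intro mult_right_mono) auto
    thus "r * s + (1 / r) * (1 - s) \<le> q * r + (1 - q) / r"
      by (simp add: algebra_simps diff_divide_distrib)
  qed (use s \<open>r > 0\<close> in auto)
  finally show ?thesis .
qed

text \<open>A wrong median lies on one side of the interval together with half of the samples; the
  union bound over the two sides costs the factor 2.\<close>

lemma error_prob_le:
  assumes low: "measure_pmf.prob core {x. x < real (card (sol n F)) / (1 + \<epsilon>)} \<le> q"
    and high: "measure_pmf.prob core {x. x > (1 + \<epsilon>) * real (card (sol n F))} \<le> q"
    and "r \<ge> 1"
  shows "error_prob n F \<epsilon> core t \<le> 2 * (q * r + (1 - q) / r) ^ t"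
proof -
  let ?M = "replicate_pmf t core"
  let ?hits = "\<lambda>P. {xs :: real list. length xs \<le> 2 * length (filter P xs)}"
  let ?A = "?hits (\<lambda>x. x < real (card (sol n F)) / (1 + \<epsilon>))"
  let ?B = "?hits (\<lambda>x. x > (1 + \<epsilon>) * real (card (sol n F)))"
  have "Error n F \<epsilon> \<subseteq> ?A \<union> ?B"
    using median_less_imp_half median_greater_imp_half by (force simp: Error_def not_le)
  hence "error_prob n F \<epsilon> core t \<le> measure_pmf.prob ?M (?A \<union> ?B)"
    unfolding error_prob_def by (intro measure_pmf.finite_measure_mono) auto
  also have "\<dots> \<le> measure_pmf.prob ?M ?A + measure_pmf.prob ?M ?B"
    by (intro measure_Un_le) auto
  finally show ?thesis
    using prob_half_hits_le[OF low \<open>r \<ge> 1\<close>, of t] prob_half_hits_le[OF high \<open>r \<ge> 1\<close>, of t] by linarith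
qed

text \<open>With \<open>k = ln c - ln b > 0\<close>, \<open>b ^ t\<close> is \<open>c ^ t\<close>
  times \<open>exp (- k * t)\<close>, which decays faster than \<open>t powr (-1/2)\<close>. The
  bound along all \<open>t\<close> is then restricted to odd \<open>t\<close>.\<close>

lemma error_prob_bigo:
  assumes "\<And>t. error_prob n F \<epsilon> core t \<le> 2 * b ^ t" and "0 < b" "b < c"
  shows "error_prob n F \<epsilon> core \<in> O[odd_at_top](\<lambda>t. real t powr (-1/2) * c ^ t)"
proof -
  define k where "k = ln c - ln b"
  have "0 < c" "0 < k"
    using \<open>0 < b\<close> \<open>b < c\<close> by (simp_all add: k_def)
  have "error_prob n F \<epsilon> core \<in> O[at_top](\<lambda>t. b ^ t)"
    using assms by (intro bigoI[of _ 2] always_eventually) (auto simp: error_prob_def)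
  also have "(\<lambda>t. b ^ t) = (\<lambda>t. exp (- k * real t) * c ^ t)"
  proof
    fix t
    have "exp (- k) * c = b"
      using \<open>0 < b\<close> \<open>0 < c\<close> by (simp add: k_def exp_minus exp_diff)
    hence "b ^ t = exp (- k) ^ t * c ^ t"
      by (simp add: power_mult_distrib[symmetric])
    thus "b ^ t = exp (- k * real t) * c ^ t"
      by (simp add: exp_of_nat_mult[symmetric] mult.commute)
  qed
  also have "(\<lambda>t. exp (- k * real t)) \<in> O[at_top](\<lambda>t. real t powr (-1/2))"
    using \<open>0 < k\<close> by real_asymp
  hence "(\<lambda>t. exp (- k * real t) * c ^ t) \<in> O[at_top](\<lambda>t. real t powr (-1/2) * c ^ t)"
    by (rule landau_o.big.mult_right)
  finally show ?thesis
    by (rule landau_o.big.filter_mono[rotated]) (simp add: odd_at_top_def)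
qed

section \<open>The size of a random cell\<close>

text \<open>The last \<open>n - i\<close> bits are free; \<open>drop i\<close> inverts appending
  them to \<open>\<gamma>\<close>. The case \<open>i = 0\<close> gives the size of the cube.\<close>

lemma card_take_eq:
  assumes "i \<le> n" "length \<gamma> = i"
  shows "card {\<beta> \<in> cube n. take i \<beta> = \<gamma>} = 2 ^ (n - i)"
proof -
  have "bij_betw (\<lambda>\<delta>. \<gamma> @ \<delta>) (cube (n - i)) {\<beta> \<in> cube n. take i \<beta> = \<gamma>}"
    using assms by (intro bij_betw_byWitness[where f' = "drop i"])
      (auto simp: cube_def, metis append_take_drop_id)
  hence "card {\<beta> \<in> cube n. take i \<beta> = \<gamma>} = card (cube (n - i))"
    by (simp add: bij_betw_same_card)
  also have "\<dots> = 2 ^ (n - i)"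
    using card_lists_length_eq[of "UNIV :: bool set" "n - i"] by (simp add: cube_def)
  finally show ?thesis .
qed

text \<open>Strong universality speaks of pairs of distinct points, so a second solution serves as
  partner when the hash value of a single one is considered.\<close>

locale hashed_solutions =
  fixes n :: nat and F :: cnf and H :: "hash set"
  assumes universal: "strongly_2_universal n H"
    and two_solutions: "2 \<le> card (sol n F)"
begin

abbreviation "M \<equiv> measure_pmf (pmf_of_set H)"

definition \<mu> :: "nat \<Rightarrow> real" where
  "\<mu> i = real (card (sol n F)) / 2 ^ i"

lemma \<mu>_pos: "\<mu> i > 0"
  using two_solutions by (simp add: \<mu>_def)

lemma set_pmf_H: "set_pmf (pmf_of_set H) = H"
  using universal strongly_2_universal_finite[OF universal]
  by (simp add: strongly_2_universal_def)

lemma integrable_H [simp]: "integrable M (f :: hash \<Rightarrow> real)"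
  using strongly_2_universal_finite[OF universal]
  by (intro integrable_measure_pmf_finite) (simp add: set_pmf_H)

lemma hash_in_cube: "h \<in> H \<Longrightarrow> x \<in> cube n \<Longrightarrow> h x \<in> cube n"
  using universal by (auto simp: strongly_2_universal_def)

lemma prob_points:
  assumes "x \<in> cube n" "y \<in> cube n" "x \<noteq> y" "a \<in> cube n" "b \<in> cube n"
  shows "measure M {h. h x = a \<and> h y = b} = 1 / (2 ^ n * 2 ^ n)"
proof -
  have "\<forall>x\<in>cube n. \<forall>y\<in>cube n. x \<noteq> y \<longrightarrow> (\<forall>\<alpha>\<in>cube n. \<forall>\<beta>\<in>cube n.
      measure M {h. h x = \<alpha> \<and> h y = \<beta>} = 1 / 2 ^ (2 * n))"
    using universal by (simp add: strongly_2_universal_def)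
  from this[rule_format, OF assms] show ?thesis
    by (simp add: mult_2 power_add)
qed

text \<open>Every pair of values of \<open>(h x, h y)\<close> in \<open>A \<times> B\<close> has the
  same mass, so the probability is a matter of counting.\<close>

lemma prob_pair:
  assumes "x \<in> cube n" "y \<in> cube n" "x \<noteq> y" "A \<subseteq> cube n" "B \<subseteq> cube n"
  shows "measure M {h. h x \<in> A \<and> h y \<in> B} = real (card A) * real (card B) / (2 ^ n * 2 ^ n)"
proof -
  have fin: "finite A" "finite B"
    using assms(4,5) by (auto intro: finite_subset[OF _ finite_cube])
  let ?D = "map_pmf (\<lambda>h. (h x, h y)) (pmf_of_set H)"
  have pmf_D: "pmf ?D ab = 1 / (2 ^ n * 2 ^ n)" if ab_in: "ab \<in> A \<times> B" for ab
  proof -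
    obtain a b where ab: "ab = (a, b)" "a \<in> cube n" "b \<in> cube n"
      using ab_in assms(4,5) by (cases ab) auto
    have "(\<lambda>h. (h x, h y)) -` {ab} = {h. h x = a \<and> h y = b}"
      using ab by auto
    thus ?thesis
      using prob_points[OF assms(1-3) ab(2,3)] by (simp add: pmf_map)
  qed
  have "measure M {h. h x \<in> A \<and> h y \<in> B} = measure ?D (A \<times> B)"
    by (simp add: vimage_def)
  also have "\<dots> = (\<Sum>ab\<in>A \<times> B. pmf ?D ab)"
    using fin by (intro measure_measure_pmf_finite) simp
  also have "\<dots> = (\<Sum>ab\<in>A \<times> B. 1 / (2 ^ n * 2 ^ n))"
    using pmf_D by (intro sum.cong refl)
  finally show ?thesis
    by (simp add: card_cartesian_product)
qed

definition hit :: "bool list \<Rightarrow> nat \<Rightarrow> bool list \<Rightarrow> hash set" where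
  "hit \<alpha> i y = {h. take i (h y) = take i \<alpha>}"

lemma prob_hit_pair:
  assumes "i \<le> n" "\<alpha> \<in> cube n" "y \<in> cube n" "z \<in> cube n" "y \<noteq> z"
  shows "measure M (hit \<alpha> i y) = 1 / 2 ^ i"
    and "measure M (hit \<alpha> i y \<inter> hit \<alpha> i z) = 1 / (2 ^ i * 2 ^ i)"
proof -
  define T where "T = {\<beta> \<in> cube n. take i \<beta> = take i \<alpha>}"
  have "card T = 2 ^ (n - i)"
    unfolding T_def using assms by (intro card_take_eq) (auto simp: cube_def)
  hence "real (card T) = 2 ^ (n - i)"
    by simp
  hence card_T: "real (card T) = 2 ^ n / 2 ^ i"
    using \<open>i \<le> n\<close> by (simp add: power_diff)
  have card_cube: "real (card (cube n)) = 2 ^ n"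
    using card_take_eq[of 0 n "[]"] by simp
  have mem: "take i (h x) = take i \<alpha> \<longleftrightarrow> h x \<in> T" if "h \<in> H" "x \<in> cube n" for h x
    using hash_in_cube[OF that] by (simp add: T_def)
  \<comment> \<open>A single point is a pair whose second value is unrestricted. The two events
    agree on \<open>H\<close> only, hence almost surely.\<close>
  have "measure M (hit \<alpha> i y) = measure M {h. h y \<in> T \<and> h z \<in> cube n}"
    using assms mem hash_in_cube by (intro measure_pmf.finite_measure_eq_AE)
      (auto simp: AE_measure_pmf_iff set_pmf_H hit_def)
  also have "\<dots> = real (card T) * real (card (cube n)) / (2 ^ n * 2 ^ n)"
    using assms by (intro prob_pair) (auto simp: T_def)
  finally show "measure M (hit \<alpha> i y) = 1 / 2 ^ i"
    by (simp add: card_T card_cube)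
  have "measure M (hit \<alpha> i y \<inter> hit \<alpha> i z) = measure M {h. h y \<in> T \<and> h z \<in> T}"
    using assms mem by (intro measure_pmf.finite_measure_eq_AE)
      (auto simp: AE_measure_pmf_iff set_pmf_H hit_def)
  also have "\<dots> = real (card T) * real (card T) / (2 ^ n * 2 ^ n)"
    using assms by (intro prob_pair) (auto simp: T_def)
  finally show "measure M (hit \<alpha> i y \<inter> hit \<alpha> i z) = 1 / (2 ^ i * 2 ^ i)"
    by (simp add: card_T)
qed

lemma prob_hit:
  assumes "i \<le> n" "\<alpha> \<in> cube n" "y \<in> sol n F"
  shows "measure M (hit \<alpha> i y) = 1 / 2 ^ i"
proof -
  have "\<not> sol n F \<subseteq> {y}"
    using two_solutions card_mono[of "{y}" "sol n F"] by auto
  then obtain z where "z \<in> sol n F" "z \<noteq> y"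
    by auto
  thus ?thesis
    using assms prob_hit_pair(1)[of i \<alpha> y z] by (auto simp: sol_def)
qed

lemma cnt_eq_sum_hit: "real (cnt n F h \<alpha> i) = (\<Sum>y\<in>sol n F. indicator (hit \<alpha> i y) h)"
proof -
  have "cell n F h \<alpha> i = {y \<in> sol n F. h \<in> hit \<alpha> i y}"
    by (auto simp: cell_def hit_def)
  thus ?thesis
    by (simp add: cnt_def indicator_def sum.If_cases Int_def)
qed

lemma expectation_cnt:
  assumes "i \<le> n" "\<alpha> \<in> cube n"
  shows "measure_pmf.expectation (pmf_of_set H) (\<lambda>h. real (cnt n F h \<alpha> i)) = \<mu> i"
  using assms by (simp add: cnt_eq_sum_hit Bochner_Integration.integral_sum prob_hit \<mu>_def)

text \<open>In the double sum for the second moment the diagonal contributes the mean. Granting the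
  diagonal an extra \<open>1 / (2 ^ i * 2 ^ i)\<close> completes the rest to the squared mean, which
  cancels.\<close>

lemma variance_cnt:
  assumes "i \<le> n" "\<alpha> \<in> cube n"
  shows "measure_pmf.variance (pmf_of_set H) (\<lambda>h. real (cnt n F h \<alpha> i)) \<le> \<mu> i"
proof -
  let ?S = "sol n F" and ?E = "measure_pmf.expectation (pmf_of_set H)"
  have pair: "measure M (hit \<alpha> i y \<inter> hit \<alpha> i z) \<le> (if y = z then 1 / 2 ^ i else 0) + 1 / (2 ^ i * 2 ^ i)"
    if "y \<in> ?S" "z \<in> ?S" for y z
    using assms that prob_hit[of i \<alpha> y] prob_hit_pair(2)[of i \<alpha> y z] by (auto simp: sol_def)
  have "(real (cnt n F h \<alpha> i))\<^sup>2 = (\<Sum>y\<in>?S. \<Sum>z\<in>?S. indicator (hit \<alpha> i y \<inter> hit \<alpha> i z) h)" for h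
    by (simp add: cnt_eq_sum_hit power2_eq_square sum_product indicator_inter_arith)
  hence "?E (\<lambda>h. (real (cnt n F h \<alpha> i))\<^sup>2)
      = (\<Sum>y\<in>?S. \<Sum>z\<in>?S. measure M (hit \<alpha> i y \<inter> hit \<alpha> i z))"
    by (simp add: Bochner_Integration.integral_sum)
  also have "\<dots> \<le> (\<Sum>y\<in>?S. \<Sum>z\<in>?S. (if y = z then 1 / 2 ^ i else 0) + 1 / (2 ^ i * 2 ^ i))"
    using pair by (intro sum_mono)
  also have "\<dots> = \<mu> i + (real (card ?S))\<^sup>2 / (2 ^ i * 2 ^ i)"
    by (simp add: sum.distrib sum.delta \<mu>_def power2_eq_square distrib_left)
  also have "(real (card ?S))\<^sup>2 / (2 ^ i * 2 ^ i) = (\<mu> i)\<^sup>2"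
    by (simp add: \<mu>_def power2_eq_square)
  finally show ?thesis
    by (subst measure_pmf.variance_eq) (simp_all add: expectation_cnt assms)
qed

lemma prob_cnt_ge:
  assumes "i \<le> n" "\<alpha> \<in> cube n" "a > 0"
  shows "measure M {h. real (cnt n F h \<alpha> i) \<ge> \<mu> i + a} \<le> \<mu> i / (\<mu> i + a\<^sup>2)"
  using measure_pmf.Cantelli_inequality[of "\<lambda>h. real (cnt n F h \<alpha> i)" "pmf_of_set H" "\<mu> i" a]
    variance_cnt[OF assms(1,2)] assms \<mu>_pos[of i] by (simp add: expectation_cnt)

lemma prob_cnt_le:
  assumes "i \<le> n" "\<alpha> \<in> cube n" "a > 0"
  shows "measure M {h. real (cnt n F h \<alpha> i) \<le> \<mu> i - a} \<le> \<mu> i / (\<mu> i + a\<^sup>2)"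
proof -
  have "measure_pmf.variance (pmf_of_set H) (\<lambda>h. - real (cnt n F h \<alpha> i)) \<le> \<mu> i"
    using variance_cnt[OF assms(1,2)] by (simp add: expectation_cnt assms power2_commute)
  hence "measure M {h. - \<mu> i + a \<le> - real (cnt n F h \<alpha> i)} \<le> \<mu> i / (\<mu> i + a\<^sup>2)"
    using measure_pmf.Cantelli_inequality[of "\<lambda>h. - real (cnt n F h \<alpha> i)" "pmf_of_set H" "\<mu> i" a]
      assms \<mu>_pos[of i] by (simp add: expectation_cnt)
  moreover have "{h. - \<mu> i + a \<le> - real (cnt n F h \<alpha> i)} = {h. real (cnt n F h \<alpha> i) \<le> \<mu> i - a}"
    by auto
  ultimately show ?thesis
    by simp
qed

lemma prob_cnt_deviates:
  assumes "i \<le> n" "\<alpha> \<in> cube n" "a > 0"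
  shows "measure M {h. \<bar>real (cnt n F h \<alpha> i) - \<mu> i\<bar> \<ge> a} \<le> \<mu> i / a\<^sup>2"
proof -
  have "measure M {h. \<bar>real (cnt n F h \<alpha> i) - \<mu> i\<bar> \<ge> a}
      \<le> measure_pmf.variance (pmf_of_set H) (\<lambda>h. real (cnt n F h \<alpha> i)) / a\<^sup>2"
    using measure_pmf.Chebyshev_inequality[of "\<lambda>h. real (cnt n F h \<alpha> i)" "pmf_of_set H" a] assms
    by (simp add: expectation_cnt)
  also have "\<dots> \<le> \<mu> i / a\<^sup>2"
    using variance_cnt[OF assms(1,2)] by (intro divide_right_mono) auto
  finally show ?thesis .
qed

text \<open>The draws of \<open>h\<close> and \<open>\<alpha>\<close> are independent and can be
  swapped; a bound for each fixed \<open>\<alpha>\<close> survives averaging over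
  \<open>\<alpha>\<close>.\<close>

lemma prob_map_core_sample_le:
  assumes "\<And>\<alpha>. \<alpha> \<in> cube n \<Longrightarrow>
    measure M {h. P (g (chosen_index n F \<epsilon> h \<alpha>, enumerated n F \<epsilon> h \<alpha>))} \<le> p"
  shows "measure_pmf.prob (map_pmf g (core_sample n F H \<epsilon>)) {x. P x} \<le> p"
proof -
  \<comment> \<open>The constant string is a member of the cube, so \<open>p\<close> bounds at least
    one probability.\<close>
  have "0 \<le> p"
    by (rule order_trans[OF measure_nonneg assms[of "replicate n True"]]) (simp add: cube_def)
  let ?f = "\<lambda>h \<alpha>. g (chosen_index n F \<epsilon> h \<alpha>, enumerated n F \<epsilon> h \<alpha>)"
  have "map_pmf g (core_sample n F H \<epsilon>)
      = pmf_of_set (cube n) \<bind> (\<lambda>\<alpha>. map_pmf (\<lambda>h. ?f h \<alpha>) (pmf_of_set H))"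
    unfolding core_sample_def map_pmf_def bind_assoc_pmf bind_return_pmf
    by (subst bind_commute_pmf) simp
  hence "emeasure (map_pmf g (core_sample n F H \<epsilon>)) {x. P x}
      = (\<integral>\<^sup>+\<alpha>. emeasure M {h. P (?f h \<alpha>)} \<partial>pmf_of_set (cube n))"
    by (simp add: vimage_def)
  also have "\<dots> \<le> (\<integral>\<^sup>+\<alpha>. ennreal p \<partial>pmf_of_set (cube n))"
    using assms by (intro nn_integral_mono_AE)
      (auto simp: AE_measure_pmf_iff measure_pmf.emeasure_eq_measure intro!: ennreal_leI)
  finally show ?thesis
    using \<open>0 \<le> p\<close> by (simp add: measure_pmf.emeasure_eq_measure)
qed

end

section \<open>Wrong estimates and deviating cells\<close>

locale counting_core = hashed_solutions +
  fixes \<epsilon> :: real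
  assumes eps_ge: "sqrt 2 - 1 \<le> \<epsilon>" and eps_less: "\<epsilon> < 1"
    and card_ge: "thresh \<epsilon> \<le> real (card (sol n F))"
begin

text \<open>The relative error allowed downwards, as
  \<open>1 / (1 + \<epsilon>) = 1 - \<rho>\<close>. In terms of it, \<open>pivot\<close> is
  \<open>9.84 / \<rho>\<^sup>2\<close> and \<open>thresh\<close> is
  \<open>(1 + \<rho>) * pivot \<epsilon>\<close>.\<close>

definition \<rho> :: real where
  "\<rho> = \<epsilon> / (1 + \<epsilon>)"

lemma eps_pos: "\<epsilon> > 0"
  using eps_ge real_sqrt_gt_1_iff[of 2] by linarith

lemma \<rho>_pos: "\<rho> > 0" and \<rho>_less: "\<rho> < 1 / 2" and \<rho>_le_eps: "\<rho> \<le> \<epsilon>"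
  using eps_pos eps_less by (simp_all add: \<rho>_def field_simps)

lemma inverse_one_plus_eps: "1 / (1 + \<epsilon>) = 1 - \<rho>"
  using eps_pos by (simp add: \<rho>_def field_simps)

lemma pivot_eq: "\<rho>\<^sup>2 * pivot \<epsilon> = 9.84"
proof -
  have "1 + 1 / \<epsilon> = 1 / \<rho>"
    using eps_pos by (simp add: \<rho>_def field_simps)
  thus ?thesis
    using \<rho>_pos by (simp add: pivot_def power_divide)
qed

lemma thresh_eq: "thresh \<epsilon> = (1 + \<rho>) * pivot \<epsilon>"
  by (simp add: thresh_def pivot_def \<rho>_def)

lemma pivot_gt: "pivot \<epsilon> > 39.36"
proof -
  have "2 < 1 + 1 / \<epsilon>"
    using eps_pos eps_less by simp
  hence "2\<^sup>2 < (1 + 1 / \<epsilon>)\<^sup>2"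
    by (intro power_strict_mono) auto
  thus ?thesis
    by (simp add: pivot_def)
qed

lemma card_sol_eq: "real (card (sol n F)) = 2 ^ i * \<mu> i"
  by (simp add: \<mu>_def)

lemma \<mu>_add: "\<mu> i = 2 ^ k * \<mu> (i + k)"
  by (simp add: \<mu>_def power_add)

lemma \<mu>_antimono: "i \<le> j \<Longrightarrow> \<mu> j \<le> \<mu> i"
  by (simp add: \<mu>_def divide_left_mono)

section \<open>The critical level and the means around it\<close>

definition level :: nat where
  "level = (LEAST i. \<mu> i \<le> pivot \<epsilon>)"

text \<open>This witness makes the \<open>LEAST\<close> in \<open>level\<close> meaningful: at most
  \<open>2 ^ n\<close> solutions give a mean of at most 1.\<close>

lemma \<mu>_n_le: "\<mu> n \<le> pivot \<epsilon>"
proof -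
  have "card (sol n F) \<le> card (cube n)"
    by (intro card_mono) (auto simp: sol_def)
  also have "card (cube n) = 2 ^ n"
    using card_take_eq[of 0 n "[]"] by simp
  finally have "real (card (sol n F)) \<le> 2 ^ n"
    by (metis numeral_power_le_of_nat_cancel_iff of_nat_le_iff of_nat_numeral of_nat_power)
  hence "\<mu> n \<le> 1"
    by (simp add: \<mu>_def)
  thus ?thesis
    using pivot_gt by simp
qed

lemma level_le: "level \<le> n"
  unfolding level_def using \<mu>_n_le by (rule Least_le)

lemma \<mu>_level_le: "\<mu> level \<le> pivot \<epsilon>"
  unfolding level_def using \<mu>_n_le by (rule LeastI)

lemma \<mu>_below_level: "i < level \<Longrightarrow> pivot \<epsilon> < \<mu> i"
  unfolding level_def using not_less_Least[of i "\<lambda>i. \<mu> i \<le> pivot \<epsilon>"] by simp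

lemma level_pos: "level > 0"
proof (rule ccontr)
  assume "\<not> level > 0"
  hence "real (card (sol n F)) \<le> pivot \<epsilon>"
    using \<mu>_level_le by (simp add: \<mu>_def)
  moreover have "pivot \<epsilon> < thresh \<epsilon>"
    using \<rho>_pos pivot_gt by (simp add: thresh_eq)
  ultimately show False
    using card_ge by simp
qed

lemma \<mu>_level_gt: "pivot \<epsilon> / 2 < \<mu> level"
  using \<mu>_below_level[of "level - 1"] \<mu>_add[of "level - 1" 1] level_pos by simp

lemma \<mu>_gt_below_level: "i + Suc k = level \<Longrightarrow> 2 ^ k * pivot \<epsilon> < \<mu> i"
  using \<mu>_below_level[of "i + k"] \<mu>_add[of i k] by simp

text \<open>Hence a cell at \<open>level\<close> that reaches \<open>thresh\<close> counts as an
  upward deviation.\<close>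

lemma thresh_ge_level: "(1 + \<rho>) * \<mu> level \<le> thresh \<epsilon>"
  unfolding thresh_eq using \<mu>_level_le \<rho>_pos by (intro mult_left_mono) auto

text \<open>Hence a count under \<open>thresh\<close> at an index before \<open>level\<close> is
  never an overestimate.\<close>

lemma thresh_less_below_level:
  assumes "i < level"
  shows "thresh \<epsilon> < (1 + \<epsilon>) * \<mu> i"
proof -
  have "(1 + \<rho>) * pivot \<epsilon> \<le> (1 + \<epsilon>) * pivot \<epsilon>"
    using \<rho>_le_eps pivot_gt by (intro mult_right_mono) auto
  also have "\<dots> < (1 + \<epsilon>) * \<mu> i"
    using \<mu>_below_level[OF assms] eps_pos by (intro mult_strict_left_mono) auto
  finally show ?thesis
    by (simp add: thresh_eq)
qed

lemma Cantelli_scaled: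
  assumes "a > 0" "k \<le> a\<^sup>2 * \<mu> i" "k > 0"
  shows "\<mu> i / (\<mu> i + (a * \<mu> i)\<^sup>2) \<le> 1 / (1 + k)"
proof -
  have "\<mu> i + (a * \<mu> i)\<^sup>2 = \<mu> i * (1 + a\<^sup>2 * \<mu> i)"
    by (simp add: power2_eq_square algebra_simps)
  hence "\<mu> i / (\<mu> i + (a * \<mu> i)\<^sup>2) = 1 / (1 + a\<^sup>2 * \<mu> i)"
    using \<mu>_pos[of i] by simp
  also have "\<dots> \<le> 1 / (1 + k)"
    using assms by (intro divide_left_mono) auto
  finally show ?thesis .
qed

text \<open>Since \<open>\<rho>\<^sup>2 * pivot \<epsilon>\<close> is constant, the tail bounds
  become numbers free of \<open>\<epsilon>\<close>.\<close>

lemma \<rho>_sq_\<mu>_ge: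
  assumes "c * pivot \<epsilon> \<le> \<mu> i"
  shows "9.84 * c \<le> \<rho>\<^sup>2 * \<mu> i"
proof -
  have "9.84 * c = \<rho>\<^sup>2 * (c * pivot \<epsilon>)"
    using pivot_eq by (metis mult.commute mult.left_commute)
  also have "\<dots> \<le> \<rho>\<^sup>2 * \<mu> i"
    using assms by (intro mult_left_mono) auto
  finally show ?thesis .
qed

section \<open>Tail bounds at and before the critical level\<close>

context
  fixes \<alpha> :: "bool list"
  assumes \<alpha>: "\<alpha> \<in> cube n"
begin

lemma prob_cell_small:
  assumes "i \<le> n" "c * pivot \<epsilon> \<le> \<mu> i" "c > 0"
  shows "measure M {h. real (cnt n F h \<alpha> i) < (1 - \<rho>) * \<mu> i} \<le> 1 / (1 + 9.84 * c)"
proof -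
  have "measure M {h. real (cnt n F h \<alpha> i) < (1 - \<rho>) * \<mu> i}
      \<le> measure M {h. real (cnt n F h \<alpha> i) \<le> \<mu> i - \<rho> * \<mu> i}"
    by (intro measure_pmf.finite_measure_mono) (auto simp: algebra_simps)
  also have "\<dots> \<le> \<mu> i / (\<mu> i + (\<rho> * \<mu> i)\<^sup>2)"
    using assms \<alpha> \<rho>_pos \<mu>_pos by (intro prob_cnt_le) auto
  also have "\<dots> \<le> 1 / (1 + 9.84 * c)"
    using assms \<rho>_pos by (intro Cantelli_scaled \<rho>_sq_\<mu>_ge) auto
  finally show ?thesis .
qed

lemma prob_level_large:
  "measure M {h. (1 + \<rho>) * \<mu> level \<le> real (cnt n F h \<alpha> level)} \<le> 1 / 5.92"
proof -
  have "measure M {h. (1 + \<rho>) * \<mu> level \<le> real (cnt n F h \<alpha> level)}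
      \<le> measure M {h. \<mu> level + \<rho> * \<mu> level \<le> real (cnt n F h \<alpha> level)}"
    by (intro measure_pmf.finite_measure_mono) (auto simp: algebra_simps)
  also have "\<dots> \<le> \<mu> level / (\<mu> level + (\<rho> * \<mu> level)\<^sup>2)"
    using level_le \<alpha> \<rho>_pos \<mu>_pos by (intro prob_cnt_ge) auto
  also have "\<dots> \<le> 1 / (1 + 9.84 * (1 / 2))"
    using \<rho>_pos \<mu>_level_gt by (intro Cantelli_scaled \<rho>_sq_\<mu>_ge) auto
  finally show ?thesis
    by simp
qed

text \<open>Chebyshev covers both tails at once and beats the \<open>2 / 5.92\<close> of two
  Cantelli bounds.\<close>

lemma prob_level_deviates:
  "measure M {h. real (cnt n F h \<alpha> level) < (1 - \<rho>) * \<mu> level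
                \<or> (1 + \<rho>) * \<mu> level \<le> real (cnt n F h \<alpha> level)} \<le> 1 / 4.92"
proof -
  have "measure M {h. real (cnt n F h \<alpha> level) < (1 - \<rho>) * \<mu> level
                \<or> (1 + \<rho>) * \<mu> level \<le> real (cnt n F h \<alpha> level)}
      \<le> measure M {h. \<rho> * \<mu> level \<le> \<bar>real (cnt n F h \<alpha> level) - \<mu> level\<bar>}"
    by (intro measure_pmf.finite_measure_mono) (auto simp: algebra_simps)
  also have "\<dots> \<le> \<mu> level / (\<rho> * \<mu> level)\<^sup>2"
    using level_le \<alpha> \<rho>_pos \<mu>_pos by (intro prob_cnt_deviates) auto
  also have "\<dots> = 1 / (\<rho>\<^sup>2 * \<mu> level)"
    using \<mu>_pos[of level] by (simp add: power2_eq_square)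
  also have "\<dots> \<le> 1 / 4.92"
    using \<rho>_sq_\<mu>_ge[of "1 / 2" level] \<mu>_level_gt by (intro divide_left_mono) auto
  finally show ?thesis .
qed

text \<open>Here \<open>thresh\<close> is at most \<open>3 / 2 * pivot \<epsilon>\<close>, less than
  \<open>3 / 8\<close> of the mean, so the count must fall short by \<open>5 / 8\<close> of
  it.\<close>

lemma prob_crossing_far_below:
  assumes "i \<le> n" "4 * pivot \<epsilon> < \<mu> i"
  shows "measure M {h. real (cnt n F h \<alpha> i) < thresh \<epsilon>} \<le> 1 / 62.5"
proof -
  have "thresh \<epsilon> \<le> 3 / 2 * pivot \<epsilon>"
    unfolding thresh_eq using \<rho>_less pivot_gt by (intro mult_right_mono) auto
  hence "measure M {h. real (cnt n F h \<alpha> i) < thresh \<epsilon>}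
      \<le> measure M {h. real (cnt n F h \<alpha> i) \<le> \<mu> i - 5 / 8 * \<mu> i}"
    using assms by (intro measure_pmf.finite_measure_mono) auto
  also have "\<dots> \<le> \<mu> i / (\<mu> i + (5 / 8 * \<mu> i)\<^sup>2)"
    using assms \<alpha> \<mu>_pos by (intro prob_cnt_le) auto
  \<comment> \<open>61.5 is \<open>(5 / 8)\<^sup>2 * 4 * 39.36\<close>, by the lower bound on
    \<open>pivot\<close>.\<close>
  also have "\<dots> \<le> 1 / (1 + 61.5)"
    using assms pivot_gt by (intro Cantelli_scaled) (auto simp: power2_eq_square)
  finally show ?thesis
    by simp
qed

text \<open>The third event uses \<open>thresh\<close> because counts decrease with the index:
  stopping anywhere up to \<open>level - 3\<close> forces a count under \<open>thresh\<close> at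
  \<open>level - 3\<close>.\<close>

definition stops_early :: "hash \<Rightarrow> bool" where
  "stops_early h \<longleftrightarrow>
     (\<exists>i. i + 1 = level \<and> real (cnt n F h \<alpha> i) < (1 - \<rho>) * \<mu> i) \<or>
     (\<exists>i. i + 2 = level \<and> real (cnt n F h \<alpha> i) < (1 - \<rho>) * \<mu> i) \<or>
     (\<exists>i. i + 3 = level \<and> real (cnt n F h \<alpha> i) < thresh \<epsilon>)"

text \<open>Quantifying over \<open>i\<close> with \<open>i + k = level\<close> avoids the truncated subtraction \<open>level - k\<close>: the
  event is empty if \<open>level < k\<close>.\<close>

lemma prob_shifted_level:
  assumes "\<And>i. i + k = level \<Longrightarrow> measure M {h. P h i} \<le> p" "0 \<le> p"
  shows "measure M {h. \<exists>i. i + k = level \<and> P h i} \<le> p"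
proof (cases "k \<le> level")
  case True
  hence "{h. \<exists>i. i + k = level \<and> P h i} = {h. P h (level - k)}"
    by (metis (no_types, lifting) add_diff_cancel_right' le_add_diff_inverse2)
  thus ?thesis
    using assms(1)[of "level - k"] True by simp
next
  case False
  hence none: "{h. \<exists>i. i + k = level \<and> P h i} = {}"
    by auto
  show ?thesis
    unfolding none using \<open>0 \<le> p\<close> by simp
qed

lemma prob_stops_early: "measure M {h. stops_early h} \<le> 1 / 10.84 + 1 / 20.68 + 1 / 62.5"
proof -
  let ?A = "{h. \<exists>i. i + 1 = level \<and> real (cnt n F h \<alpha> i) < (1 - \<rho>) * \<mu> i}"
  let ?B = "{h. \<exists>i. i + 2 = level \<and> real (cnt n F h \<alpha> i) < (1 - \<rho>) * \<mu> i}"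
  let ?C = "{h. \<exists>i. i + 3 = level \<and> real (cnt n F h \<alpha> i) < thresh \<epsilon>}"
  have "measure M ?A \<le> 1 / 10.84"
  proof (rule prob_shifted_level)
    fix i assume "i + 1 = level"
    thus "measure M {h. real (cnt n F h \<alpha> i) < (1 - \<rho>) * \<mu> i} \<le> 1 / 10.84"
      using prob_cell_small[of i 1] \<mu>_gt_below_level[of i 0] level_le by simp
  qed simp
  moreover have "measure M ?B \<le> 1 / 20.68"
  proof (rule prob_shifted_level)
    fix i assume "i + 2 = level"
    thus "measure M {h. real (cnt n F h \<alpha> i) < (1 - \<rho>) * \<mu> i} \<le> 1 / 20.68"
      using prob_cell_small[of i 2] \<mu>_gt_below_level[of i 1] level_le by simp
  qed simp
  moreover have "measure M ?C \<le> 1 / 62.5"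
  proof (rule prob_shifted_level)
    fix i assume "i + 3 = level"
    thus "measure M {h. real (cnt n F h \<alpha> i) < thresh \<epsilon>} \<le> 1 / 62.5"
      using \<mu>_gt_below_level[of i 2] level_le by (intro prob_crossing_far_below) auto
  qed simp
  moreover have "{h. stops_early h} = ?A \<union> ?B \<union> ?C"
    by (auto simp: stops_early_def)
  moreover have "measure M (?A \<union> ?B \<union> ?C) \<le> measure M ?A + measure M ?B + measure M ?C"
    using measure_Un_le[of "?A \<union> ?B" M ?C] measure_Un_le[of ?A M ?B] by simp
  ultimately show ?thesis
    by simp
qed

section \<open>Position of the chosen index relative to the critical level\<close>

lemma level_le_chosen_index:
  assumes "thresh \<epsilon> \<le> real (cnt n F h \<alpha> level)"
  shows "level \<le> chosen_index n F \<epsilon> h \<alpha>"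
proof (cases "\<exists>m. is_crossing n F \<epsilon> h \<alpha> m")
  case True
  then obtain m where m: "is_crossing n F \<epsilon> h \<alpha> m" ..
  hence "chosen_index n F \<epsilon> h \<alpha> = m"
    using is_crossing_unique unfolding chosen_index_def by (auto intro!: the_equality)
  moreover have "level \<le> m"
  proof (rule ccontr)
    assume "\<not> level \<le> m"
    hence "cnt n F h \<alpha> level \<le> cnt n F h \<alpha> m"
      by (intro cnt_antimono) simp
    thus False
      using m assms unfolding is_crossing_def by linarith
  qed
  ultimately show ?thesis by simp
\<comment> \<open>Without a crossing the index defaults to \<open>n\<close>, which is at least
  \<open>level\<close>.\<close>
qed (use level_le in \<open>simp add: chosen_index_def\<close>)

text \<open>The first index with a count under \<open>thresh\<close> is the crossing. It is not 0,
  where all solutions are counted, and the cap on the enumeration does not cut its cell.\<close>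

lemma chosen_index_le_level:
  assumes "real (cnt n F h \<alpha> level) < thresh \<epsilon>"
  shows "chosen_index n F \<epsilon> h \<alpha> \<le> level"
    and "real (cnt n F h \<alpha> (chosen_index n F \<epsilon> h \<alpha>)) < thresh \<epsilon>"
    and "enumerated n F \<epsilon> h \<alpha> = cnt n F h \<alpha> (chosen_index n F \<epsilon> h \<alpha>)"
proof -
  define m where "m = (LEAST m. real (cnt n F h \<alpha> m) < thresh \<epsilon>)"
  have small: "real (cnt n F h \<alpha> m) < thresh \<epsilon>"
    unfolding m_def using assms by (rule LeastI)
  have le: "m \<le> level"
    unfolding m_def using assms by (rule Least_le)
  have "m \<noteq> 0"
    using small card_ge by (metis cnt_0 not_less)
  moreover from this have "thresh \<epsilon> \<le> real (cnt n F h \<alpha> (m - 1))"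
    using not_less_Least[of "m - 1" "\<lambda>m. real (cnt n F h \<alpha> m) < thresh \<epsilon>"]
    by (simp add: m_def[symmetric])
  ultimately have "is_crossing n F \<epsilon> h \<alpha> m"
    using small le level_le by (simp add: is_crossing_def)
  hence chosen: "chosen_index n F \<epsilon> h \<alpha> = m"
    using is_crossing_unique unfolding chosen_index_def by (auto intro!: the_equality)
  show "chosen_index n F \<epsilon> h \<alpha> \<le> level"
    and "real (cnt n F h \<alpha> (chosen_index n F \<epsilon> h \<alpha>)) < thresh \<epsilon>"
    using le small by (simp_all add: chosen)
  have "cnt n F h \<alpha> m \<le> nat \<lceil>thresh \<epsilon>\<rceil>"
    using small by linarith
  thus "enumerated n F \<epsilon> h \<alpha> = cnt n F h \<alpha> (chosen_index n F \<epsilon> h \<alpha>)"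
    by (simp add: enumerated_def chosen)
qed

lemma stops_earlyI:
  assumes "m < level" "real (cnt n F h \<alpha> m) < thresh \<epsilon>"
    and "real (cnt n F h \<alpha> m) < (1 - \<rho>) * \<mu> m"
  shows "stops_early h"
proof -
  \<comment> \<open>The equation \<open>level - 3 + 3 = level\<close> records
    \<open>3 \<le> level\<close>, so the subtraction is not truncated.\<close>
  consider "m + 1 = level" | "m + 2 = level" | "m \<le> level - 3" "level - 3 + 3 = level"
    using assms(1) by linarith
  thus ?thesis
  proof cases
    case 3
    hence "real (cnt n F h \<alpha> (level - 3)) < thresh \<epsilon>"
      using assms(2) cnt_antimono[of m "level - 3" n F h \<alpha>] by linarith
    thus ?thesis
      using 3 unfolding stops_early_def by blast
  qed (use assms in \<open>auto simp: stops_early_def\<close>)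
qed

section \<open>Wrong estimates force deviating cells\<close>

lemma estimate_low_iff:
  "2 ^ m * x < real (card (sol n F)) / (1 + \<epsilon>) \<longleftrightarrow> x < (1 - \<rho>) * \<mu> m"
proof -
  have "real (card (sol n F)) / (1 + \<epsilon>) = real (card (sol n F)) * (1 / (1 + \<epsilon>))"
    by simp
  also have "\<dots> = 2 ^ m * ((1 - \<rho>) * \<mu> m)"
    unfolding inverse_one_plus_eps card_sol_eq[of m] by simp
  finally show ?thesis
    by simp
qed

lemma estimate_high_iff:
  "(1 + \<epsilon>) * real (card (sol n F)) < 2 ^ m * x \<longleftrightarrow> (1 + \<epsilon>) * \<mu> m < x"
proof -
  have "(1 + \<epsilon>) * real (card (sol n F)) = 2 ^ m * ((1 + \<epsilon>) * \<mu> m)"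
    unfolding card_sol_eq[of m] by simp
  thus ?thesis
    by (simp only: mult_less_cancel_left_pos zero_less_power zero_less_numeral)
qed

text \<open>Stopping beyond \<open>level\<close> requires a cell of size at least
  \<open>thresh\<close> at \<open>level\<close>, so such underestimates are charged to an upward
  deviation there.\<close>

lemma approx_low:
  assumes "2 ^ chosen_index n F \<epsilon> h \<alpha> * real (enumerated n F \<epsilon> h \<alpha>)
    < real (card (sol n F)) / (1 + \<epsilon>)"
  shows "stops_early h \<or> real (cnt n F h \<alpha> level) < (1 - \<rho>) * \<mu> level
    \<or> (1 + \<rho>) * \<mu> level \<le> real (cnt n F h \<alpha> level)"
proof (cases "real (cnt n F h \<alpha> level) < thresh \<epsilon>")
  case True
  note chosen = chosen_index_le_level[OF True]
  show ?thesis
    using assms chosen(1,2) stops_earlyI[of "chosen_index n F \<epsilon> h \<alpha>" h]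
    unfolding estimate_low_iff chosen(3) by (auto simp: le_less)
qed (use thresh_ge_level in linarith)

text \<open>From \<open>level\<close> on the mean is at most \<open>pivot\<close>, and
  \<open>\<epsilon> \<ge> sqrt 2 - 1\<close> gives \<open>1 - \<rho> \<le> 1 / sqrt 2\<close>; thus
  the rounded value is large enough and the index must come earlier.\<close>

lemma round_low:
  assumes "2 ^ chosen_index n F \<epsilon> h \<alpha> * max (real (enumerated n F \<epsilon> h \<alpha>)) (pivot \<epsilon> / sqrt 2)
    < real (card (sol n F)) / (1 + \<epsilon>)"
  shows "stops_early h"
proof -
  let ?m = "chosen_index n F \<epsilon> h \<alpha>"
  have less: "real (enumerated n F \<epsilon> h \<alpha>) < (1 - \<rho>) * \<mu> ?m" "pivot \<epsilon> / sqrt 2 < (1 - \<rho>) * \<mu> ?m"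
    using assms unfolding estimate_low_iff by simp_all
  have "?m < level"
  proof (rule ccontr)
    assume "\<not> ?m < level"
    hence "\<mu> ?m \<le> pivot \<epsilon>"
      using \<mu>_antimono[of level ?m] \<mu>_level_le by simp
    moreover have "1 - \<rho> \<le> 1 / sqrt 2"
      unfolding inverse_one_plus_eps[symmetric] using eps_ge eps_pos by (intro divide_left_mono) auto
    ultimately have "(1 - \<rho>) * \<mu> ?m \<le> 1 / sqrt 2 * pivot \<epsilon>"
      using \<mu>_pos[of ?m] \<rho>_less by (intro mult_mono) auto
    thus False
      using less(2) by simp
  qed
  hence "real (cnt n F h \<alpha> level) < thresh \<epsilon>"
    using level_le_chosen_index[of h] by linarith
  from chosen_index_le_level[OF this] show ?thesis
    using less(1) \<open>?m < level\<close> by (intro stops_earlyI[of ?m]) auto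
qed

text \<open>Up to \<open>level\<close> the mean exceeds \<open>pivot \<epsilon> / 2\<close>, and
  \<open>1 + \<epsilon> \<ge> sqrt 2\<close>, so rounding up causes no overestimate. The count
  itself would have to be too large, which \<open>thresh\<close> excludes before
  \<open>level\<close>.\<close>

lemma round_high:
  assumes "(1 + \<epsilon>) * real (card (sol n F))
    < 2 ^ chosen_index n F \<epsilon> h \<alpha> * max (real (enumerated n F \<epsilon> h \<alpha>)) (pivot \<epsilon> / sqrt 2)"
  shows "(1 + \<rho>) * \<mu> level \<le> real (cnt n F h \<alpha> level)"
proof (rule ccontr)
  let ?m = "chosen_index n F \<epsilon> h \<alpha>"
  assume small: "\<not> ?thesis"
  hence "real (cnt n F h \<alpha> level) < thresh \<epsilon>"
    using thresh_ge_level by linarith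
  note chosen = chosen_index_le_level[OF this]
  have "sqrt 2 * (pivot \<epsilon> / 2) \<le> (1 + \<epsilon>) * \<mu> ?m"
    using eps_ge eps_pos pivot_gt \<mu>_level_gt \<mu>_antimono[OF chosen(1)] by (intro mult_mono) auto
  moreover have "sqrt 2 * (pivot \<epsilon> / 2) = pivot \<epsilon> / sqrt 2"
    by (simp add: field_simps)
  ultimately have "\<not> (1 + \<epsilon>) * \<mu> ?m < pivot \<epsilon> / sqrt 2"
    by linarith
  hence large: "(1 + \<epsilon>) * \<mu> ?m < real (cnt n F h \<alpha> ?m)"
    using assms unfolding estimate_high_iff chosen(3) less_max_iff_disj by blast
  have "\<not> ?m < level"
    using thresh_less_below_level[of ?m] chosen(2) large by force
  moreover have "(1 + \<rho>) * \<mu> level \<le> (1 + \<epsilon>) * \<mu> level"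
    using \<rho>_le_eps \<mu>_pos[of level] by (intro mult_right_mono) auto
  ultimately show False
    using large small chosen(1) by (auto simp: le_less)
qed

end

section \<open>Error probabilities of a single invocation\<close>

lemma prob_RoundMCCore_low:
  "measure_pmf.prob (RoundMCCore n F H \<epsilon>) {x. x < real (card (sol n F)) / (1 + \<epsilon>)} \<le> 0.169"
  unfolding RoundMCCore_def
proof (rule prob_map_core_sample_le, unfold prod.case)
  fix \<alpha> assume \<alpha>: "\<alpha> \<in> cube n"
  have "measure M {h. 2 ^ chosen_index n F \<epsilon> h \<alpha>
        * max (real (enumerated n F \<epsilon> h \<alpha>)) (pivot \<epsilon> / sqrt 2)
        < real (card (sol n F)) / (1 + \<epsilon>)} \<le> measure M {h. stops_early \<alpha> h}"
    using round_low[OF \<alpha>] by (intro measure_pmf.finite_measure_mono) auto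
  thus "measure M {h. 2 ^ chosen_index n F \<epsilon> h \<alpha>
        * max (real (enumerated n F \<epsilon> h \<alpha>)) (pivot \<epsilon> / sqrt 2)
        < real (card (sol n F)) / (1 + \<epsilon>)} \<le> 0.169"
    using prob_stops_early[OF \<alpha>] by simp
qed

text \<open>This side fixes the constant: \<open>1 / 5.92\<close> is just below 0.169, while
  underestimates have probability at most about 0.157.\<close>

lemma prob_RoundMCCore_high:
  "measure_pmf.prob (RoundMCCore n F H \<epsilon>) {x. (1 + \<epsilon>) * real (card (sol n F)) < x} \<le> 0.169"
  unfolding RoundMCCore_def
proof (rule prob_map_core_sample_le, unfold prod.case)
  fix \<alpha> assume \<alpha>: "\<alpha> \<in> cube n"
  have "measure M {h. (1 + \<epsilon>) * real (card (sol n F)) < 2 ^ chosen_index n F \<epsilon> h \<alpha>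
        * max (real (enumerated n F \<epsilon> h \<alpha>)) (pivot \<epsilon> / sqrt 2)}
      \<le> measure M {h. (1 + \<rho>) * \<mu> level \<le> real (cnt n F h \<alpha> level)}"
    using round_high[OF \<alpha>] by (intro measure_pmf.finite_measure_mono) auto
  thus "measure M {h. (1 + \<epsilon>) * real (card (sol n F)) < 2 ^ chosen_index n F \<epsilon> h \<alpha>
        * max (real (enumerated n F \<epsilon> h \<alpha>)) (pivot \<epsilon> / sqrt 2)} \<le> 0.169"
    using prob_level_large[OF \<alpha>] by simp
qed

lemma prob_ApproxMCCore_low:
  "measure_pmf.prob (ApproxMCCore n F H \<epsilon>) {x. x < real (card (sol n F)) / (1 + \<epsilon>)} \<le> 0.3599"
  unfolding ApproxMCCore_def
proof (rule prob_map_core_sample_le, unfold prod.case)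
  fix \<alpha> assume \<alpha>: "\<alpha> \<in> cube n"
  let ?A = "{h. stops_early \<alpha> h}"
  let ?B = "{h. real (cnt n F h \<alpha> level) < (1 - \<rho>) * \<mu> level
    \<or> (1 + \<rho>) * \<mu> level \<le> real (cnt n F h \<alpha> level)}"
  have "measure M {h. 2 ^ chosen_index n F \<epsilon> h \<alpha> * real (enumerated n F \<epsilon> h \<alpha>)
        < real (card (sol n F)) / (1 + \<epsilon>)} \<le> measure M (?A \<union> ?B)"
    using approx_low[OF \<alpha>] by (intro measure_pmf.finite_measure_mono) auto
  also have "\<dots> \<le> measure M ?A + measure M ?B"
    by (intro measure_Un_le) auto
  finally show "measure M {h. 2 ^ chosen_index n F \<epsilon> h \<alpha> * real (enumerated n F \<epsilon> h \<alpha>)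
        < real (card (sol n F)) / (1 + \<epsilon>)} \<le> 0.3599"
    using prob_stops_early[OF \<alpha>] prob_level_deviates[OF \<alpha>] by simp
qed

text \<open>Rounding only increases the estimate, so every overestimate here is also one of the
  rounded procedure.\<close>

lemma prob_ApproxMCCore_high:
  "measure_pmf.prob (ApproxMCCore n F H \<epsilon>) {x. (1 + \<epsilon>) * real (card (sol n F)) < x} \<le> 0.3599"
  unfolding ApproxMCCore_def
proof (rule prob_map_core_sample_le, unfold prod.case)
  fix \<alpha> assume \<alpha>: "\<alpha> \<in> cube n"
  have "2 ^ m * real c \<le> 2 ^ m * max (real c) (pivot \<epsilon> / sqrt 2)" for m c :: nat
    by simp
  hence "measure M {h. (1 + \<epsilon>) * real (card (sol n F))
        < 2 ^ chosen_index n F \<epsilon> h \<alpha> * real (enumerated n F \<epsilon> h \<alpha>)}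
      \<le> measure M {h. (1 + \<rho>) * \<mu> level \<le> real (cnt n F h \<alpha> level)}"
    by (intro measure_pmf.finite_measure_mono) (auto intro!: round_high[OF \<alpha>] elim!: less_le_trans)
  thus "measure M {h. (1 + \<epsilon>) * real (card (sol n F))
        < 2 ^ chosen_index n F \<epsilon> h \<alpha> * real (enumerated n F \<epsilon> h \<alpha>)} \<le> 0.3599"
    using prob_level_large[OF \<alpha>] by simp
qed

end

theorem theorem1:
  fixes n :: nat and F :: cnf and H :: "hash set" and \<epsilon> :: real
  assumes "cnf_over n F"
    and "strongly_2_universal n H"
    and "sqrt 2 - 1 \<le> \<epsilon>" and "\<epsilon> < 1"
    and "real (card (sol n F)) \<ge> thresh \<epsilon>"
  shows "error_prob n F \<epsilon> (RoundMCCore n F H \<epsilon>)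
           \<in> O[odd_at_top](\<lambda>t. real t powr (-1/2) * 0.75 ^ t)
       \<and> error_prob n F \<epsilon> (ApproxMCCore n F H \<epsilon>)
           \<in> O[odd_at_top](\<lambda>t. real t powr (-1/2) * 0.96 ^ t)"
proof -
  have "\<epsilon> > 0"
    using assms(3) real_sqrt_gt_1_iff[of 2] by linarith
  \<comment> \<open>Dropping the positive summands leaves 9.84, enough for the two solutions that
    the locale asks for.\<close>
  have "9.84 * 1 * 1\<^sup>2 \<le> thresh \<epsilon>"
    unfolding thresh_def using \<open>\<epsilon> > 0\<close> by (intro mult_mono power_mono) auto
  hence "2 \<le> card (sol n F)"
    using assms(5) by simp
  then interpret counting_core n F H \<epsilon>
    using assms by unfold_locales auto
  text \<open>2.2175 and 4/3 approximate \<open>sqrt ((1 - q) / q)\<close>, which minimises \<open>q * r + (1 - q) / r\<close>.\<close>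
  have "error_prob n F \<epsilon> (RoundMCCore n F H \<epsilon>) t \<le> 2 * (0.169 * 2.2175 + (1 - 0.169) / 2.2175) ^ t" for t
    by (rule error_prob_le[OF prob_RoundMCCore_low prob_RoundMCCore_high]) simp
  moreover have "error_prob n F \<epsilon> (ApproxMCCore n F H \<epsilon>) t
      \<le> 2 * (0.3599 * (4 / 3) + (1 - 0.3599) / (4 / 3)) ^ t" for t
    by (rule error_prob_le[OF prob_ApproxMCCore_low prob_ApproxMCCore_high]) simp
  \<comment> \<open>The two bases are about 0.74950 and 0.95994.\<close>
  ultimately show ?thesis
    by (intro conjI error_prob_bigo) (assumption | simp)+
qed

end
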